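(* Let $\theta=(a,\kappa,\gamma)$ with $a,\kappa,\gamma\in\mathbb C$, $\operatorname{Re}(a)>0$, and let $n\in\mathbb N=\{0,1,2,\dots\}$. Let $\sqrt a$ denote the branch of the square root with $|\operatorname{Arg}(\sqrt a)|<\pi/4$. Then $$G_n(\theta)=(2\sqrt a)^{-n}\,\tilde H_n\!\left(\frac{\kappa}{2\sqrt a}\right)G_0(\theta),\qquad G_0(\theta)=e^{\frac{\kappa^2}{4a}+\gamma}\,\sqrt{\frac{\pi}{a}},$$ where $\sqrt{\pi/a}=\sqrt\pi/\sqrt a$, and the gradient of $G_n$ with respect to $\theta=(a,\kappa,\gamma)$ is $$\nabla_\theta G_n(\theta)=\big(-G_{n+2}(\theta),\;G_{n+1}(\theta),\;G_n(\theta)\big).$$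
   Context: For $\theta=(a,\kappa,\gamma)\in\mathbb C^3$ with $\operatorname{Re}(a)>0$ and $n\in\mathbb N$, the $n$-monomial Gaussian integral is $$G_n(\theta)=\int_{\mathbb R}x^n e^{-ax^2+\kappa x+\gamma}\,dx .$$ The polynomials $\tilde H_n$ are the complex scaled physicists' Hermite polynomials $\tilde H_n(x)=(-\mathrm i)^nH_n(\mathrm i x)$; equivalently $\tilde H_0(x)=1$, $\tilde H_1(x)=2x$, and $\tilde H_{n+1}(x)=2x\tilde H_n(x)+2n\tilde H_{n-1}(x)$ for $n>0$. Derivatives with respect to $a,\kappa,\gamma$ are complex (holomorphic) derivatives. *)

theory Defs
  imports "HOL-Analysis.Analysis"
begin

fun gauss_integrand :: "nat \<Rightarrow> complex \<times> complex \<times> complex \<Rightarrow> real \<Rightarrow> complex" where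
  "gauss_integrand n (a, \<kappa>, \<gamma>) x =
     complex_of_real x ^ n * exp (- a * complex_of_real x ^ 2 + \<kappa> * complex_of_real x + \<gamma>)"

definition gauss_integral :: "nat \<Rightarrow> complex \<times> complex \<times> complex \<Rightarrow> complex" where
  "gauss_integral n \<theta> = (LBINT x. gauss_integrand n \<theta> x)"

fun hermite :: "nat \<Rightarrow> complex \<Rightarrow> complex" where
  "hermite 0 x = 1"
| "hermite (Suc 0) x = 2 * x"
| "hermite (Suc (Suc n)) x = 2 * x * hermite (Suc n) x - 2 * of_nat (Suc n) * hermite n x"

definition scaled_hermite :: "nat \<Rightarrow> complex \<Rightarrow> complex" where
  "scaled_hermite n x = (- \<i>) ^ n * hermite n (\<i> * x)"

lemma scaled_hermite_0: "scaled_hermite 0 x = 1"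
  by (simp add: scaled_hermite_def)

lemma scaled_hermite_1: "scaled_hermite 1 x = 2 * x"
  by (simp add: scaled_hermite_def)

lemma scaled_hermite_rec:
  assumes "n > 0"
  shows "scaled_hermite (n + 1) x =
           2 * x * scaled_hermite n x + 2 * of_nat n * scaled_hermite (n - 1) x"
proof -
  obtain m where n: "n = Suc m"
    using assms gr0_conv_Suc by blast
  show ?thesis
    by (simp add: n scaled_hermite_def algebra_simps)
qed

(* Gradient = triple of complex partial derivatives, each of which is required to exist. *)
fun has_complex_gradient ::
    "(complex \<times> complex \<times> complex \<Rightarrow> complex) \<Rightarrow> complex \<times> complex \<times> complex
       \<Rightarrow> complex \<times> complex \<times> complex \<Rightarrow> bool" where
  "has_complex_gradient f (d1, d2, d3) (z1, z2, z3) \<longleftrightarrow>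
     ((\<lambda>z. f (z, z2, z3)) has_field_derivative d1) (at z1) \<and>
     ((\<lambda>z. f (z1, z, z3)) has_field_derivative d2) (at z2) \<and>
     ((\<lambda>z. f (z1, z2, z)) has_field_derivative d3) (at z3)"

(* On the right half-plane csqrt is the only square root with argument in (-pi/4, pi/4). *)
lemma csqrt_branch:
  assumes "Re a > 0"
  shows "s ^ 2 = a \<and> \<bar>Arg s\<bar> < pi / 4 \<longleftrightarrow> s = csqrt a"
proof
  have "\<bar>Arg a\<bar> < pi / 2"
    using Arg_Re_pos[of a] assms by metis
  then have "\<bar>Arg a / 2\<bar> < pi / 4"
    by linarith
  then have "\<bar>Arg (csqrt a)\<bar> < pi / 4"
    by (simp only: Arg_csqrt)
  then show "s ^ 2 = a \<and> \<bar>Arg s\<bar> < pi / 4" if "s = csqrt a"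
    using that power2_csqrt[of a] by metis
  assume s: "s ^ 2 = a \<and> \<bar>Arg s\<bar> < pi / 4"
  then have "\<bar>Arg s\<bar> < pi / 2"
    using pi_gt_zero by linarith
  moreover have "s \<noteq> 0"
    using s assms by fastforce
  ultimately have "Re s > 0"
    using Arg_Re_pos[of s] by metis
  then show "s = csqrt a"
    using s csqrt_unique[of s a] by metis
qed

end

theory Submission
  imports Defs "HOL-Probability.Distributions" "HOL-Real_Asymp.Real_Asymp"
begin

text \<open>
  Write \<open>G n\<close> for the integral at \<open>(a, \<kappa>, \<gamma>)\<close>. Everything follows from the gradient formula together
  with one integration by parts.

  Gradient (\<open>gauss_integral_gradient\<close>): increasing \<open>a\<close>, \<open>\<kappa>\<close> or \<open>\<gamma>\<close> by \<open>h\<close> multiplies the integrand by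
  \<open>exp (h * p x)\<close> with \<open>p x\<close> equal to \<open>- x\<^sup>2\<close>, \<open>x\<close> or \<open>1\<close>. Dominated convergence allows
  differentiation at \<open>h = 0\<close> under the integral
  as soon as the integrand remains integrable after multiplication by \<open>exp (\<delta> * norm (p x))\<close>
  for some \<open>\<delta> > 0\<close> (\<open>has_field_derivative_exponential_tilt\<close>). For \<open>p x = - x\<^sup>2\<close> there is room for this
  because \<open>Re a\<close> can be halved and stays positive.

  Recurrence (\<open>gauss_integral_recurrence\<close>): the derivative of \<open>x ^ n * exp (- a * x\<^sup>2 + \<kappa> * x + \<gamma>)\<close> has
  integral zero, which reads \<open>2 * a * G (n + 1) = \<kappa> * G n + n * G (n - 1)\<close>. Up to the factor
  \<open>(2 * csqrt a) ^ n\<close> this is the recurrence of the scaled Hermite polynomials at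
  \<open>\<kappa> / (2 * csqrt a)\<close>, and so \<open>G n / G 0\<close> is determined.

  Value of \<open>G 0\<close>: gradient and recurrence combine to the differential equations
  \<open>dG 0 / d\<kappa> = \<kappa> / (2 * a) * G 0\<close> and, for \<open>\<kappa> = 0\<close>, \<open>dG 0 / da = - G 0 / (2 * a)\<close>. The first one
  reduces the claim to \<open>\<kappa> = 0\<close>. By the second one \<open>csqrt a * G 0\<close> is constant on the right half-plane,
  and its value at \<open>a = 1\<close> is the real Gaussian integral \<open>sqrt pi\<close>. Following the principal branch from
  \<open>1\<close> through the half-plane is what selects the correct square root of a complex \<open>a\<close>.
\<close>

section \<open>Differentiating an exponential factor under the integral\<close>

lemma norm_exp_minus_one_le:
  fixes w :: complex
  shows "norm (exp w - 1) \<le> norm w * exp (norm w)"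
proof -
  have "norm (exp w - exp 0) \<le> exp (norm w) * norm (w - 0)"
  proof (rule field_differentiable_bound[of "cball 0 (norm w)"])
    fix z :: complex assume "z \<in> cball 0 (norm w)"
    then show "norm (exp z) \<le> exp (norm w)"
      using norm_exp[of z] by (smt (verit) exp_le_cancel_iff mem_cball_0)
  qed (auto intro: derivative_intros DERIV_exp has_field_derivative_at_within)
  then show ?thesis
    by (simp add: mult.commute)
qed

text \<open>
  The single hypothesis provides both integrability of the tilted functions and a dominating function:
  half of the exponent \<open>\<delta> * norm (p x)\<close> is spent on \<open>exp (h * p x)\<close>, and the other half absorbs the
  factor \<open>norm (p x)\<close> that the difference quotient produces.
\<close>
lemma has_field_derivative_exponential_tilt:
  fixes f p :: "'a \<Rightarrow> complex" and \<delta> :: real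
  assumes [measurable]: "f \<in> borel_measurable M" "p \<in> borel_measurable M"
    and \<delta>: "\<delta> > 0"
    and int: "integrable M (\<lambda>x. norm (f x) * exp (\<delta> * norm (p x)))"
  shows "((\<lambda>h. \<integral>x. f x * exp (h * p x) \<partial>M) has_field_derivative (\<integral>x. f x * p x \<partial>M)) (at 0)"
proof -
  define I where "I h = (\<integral>x. f x * exp (h * p x) \<partial>M)" for h
  define w where "w x = 2 / \<delta> * (norm (f x) * exp (\<delta> * norm (p x)))" for x
  have int_w: "integrable M w"
    unfolding w_def using int by (intro integrable_mult_right) auto
  have tilt_int: "integrable M (\<lambda>x. f x * exp (h * p x))" if "norm h \<le> \<delta>" for h
  proof (rule Bochner_Integration.integrable_bound[OF int])
    show "AE x in M. norm (f x * exp (h * p x)) \<le> norm (norm (f x) * exp (\<delta> * norm (p x)))"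
    proof (rule AE_I2)
      fix x
      have "norm (exp (h * p x)) \<le> exp (norm (h * p x))"
        by (rule norm_exp)
      also have "\<dots> \<le> exp (\<delta> * norm (p x))"
        using that by (simp add: norm_mult mult_right_mono)
      finally show "norm (f x * exp (h * p x)) \<le> norm (norm (f x) * exp (\<delta> * norm (p x)))"
        by (simp add: norm_mult mult_left_mono)
    qed
  qed measurable
  have quotient_bound: "norm (f x * ((exp (h * p x) - 1) / h)) \<le> w x"
    if "norm h \<le> \<delta> / 2" "h \<noteq> 0" for h x
  proof -
    define t where "t = norm (p x)"
    have t: "t \<ge> 0" by (simp add: t_def)
    have "norm ((exp (h * p x) - 1) / h) \<le> t * exp (norm h * t)"
      using norm_exp_minus_one_le[of "h * p x"] that(2)
      by (simp add: norm_divide norm_mult t_def field_simps)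
    also have "\<dots> \<le> t * exp (\<delta> / 2 * t)"
      using mult_right_mono[OF that(1) t] t by (intro mult_left_mono) auto
    also have "\<dots> \<le> 2 / \<delta> * exp (\<delta> / 2 * t) * exp (\<delta> / 2 * t)"
    proof (rule mult_right_mono)
      have "\<delta> / 2 * t \<le> exp (\<delta> / 2 * t)"
        using exp_ge_add_one_self[of "\<delta> / 2 * t"] by linarith
      then show "t \<le> 2 / \<delta> * exp (\<delta> / 2 * t)"
        using \<delta> by (simp add: field_simps)
    qed auto
    also have "\<dots> = 2 / \<delta> * exp (\<delta> * t)"
      by (simp add: mult.assoc flip: exp_add)
    finally have "norm ((exp (h * p x) - 1) / h) \<le> 2 / \<delta> * exp (\<delta> * t)" .
    from mult_left_mono[OF this, of "norm (f x)"] show ?thesis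
      unfolding w_def t_def norm_mult[of "f x"] by (simp add: algebra_simps)
  qed
  have "(\<lambda>h. (I h - I 0) / h) \<midarrow>0\<rightarrow> (\<integral>x. f x * p x \<partial>M)"
    unfolding tendsto_at_iff_sequentially
  proof (intro allI impI)
    fix X :: "nat \<Rightarrow> complex"
    assume X: "\<forall>i. X i \<in> UNIV - {0}" and lim: "X \<longlonglongrightarrow> 0"
    have "eventually (\<lambda>i. dist (X i) 0 < \<delta> / 2) sequentially"
      using lim \<delta> by (intro tendstoD) auto
    then obtain N where N: "\<And>i. i \<ge> N \<Longrightarrow> norm (X i) < \<delta> / 2"
      by (auto simp: eventually_sequentially)
    \<comment> \<open>The dominated convergence theorem wants its bound for every member of the sequence, hence the
      finitely many initial \<open>X i\<close> outside the disc of radius \<open>\<delta> / 2\<close> are dropped.\<close>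
    define Y where "Y i = X (i + N)" for i
    have Y: "norm (Y i) \<le> \<delta> / 2" "Y i \<noteq> 0" for i
      using N[of "i + N"] X by (auto simp: Y_def)
    have Y0: "Y \<longlonglongrightarrow> 0"
      unfolding Y_def using lim by (rule LIMSEQ_ignore_initial_segment)
    have quotient: "(I (Y i) - I 0) / Y i = (\<integral>x. f x * ((exp (Y i * p x) - 1) / Y i) \<partial>M)" for i
    proof -
      have "I (Y i) - I 0 = (\<integral>x. f x * exp (Y i * p x) - f x * exp (0 * p x) \<partial>M)"
        unfolding I_def using Y(1)[of i] \<delta>
        by (intro Bochner_Integration.integral_diff[symmetric] tilt_int) auto
      also have "\<dots> / Y i = (\<integral>x. (f x * exp (Y i * p x) - f x * exp (0 * p x)) / Y i \<partial>M)"
        by simp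
      also have "\<dots> = (\<integral>x. f x * ((exp (Y i * p x) - 1) / Y i) \<partial>M)"
        by (simp add: algebra_simps)
      finally show ?thesis .
    qed
    have "(\<lambda>i. \<integral>x. f x * ((exp (Y i * p x) - 1) / Y i) \<partial>M) \<longlonglongrightarrow> (\<integral>x. f x * p x \<partial>M)"
    proof (rule integral_dominated_convergence[OF _ _ int_w])
      show "AE x in M. (\<lambda>i. f x * ((exp (Y i * p x) - 1) / Y i)) \<longlonglongrightarrow> f x * p x"
      proof (rule AE_I2)
        fix x
        have "((\<lambda>h. exp (h * p x)) has_field_derivative p x) (at 0)"
          by (auto intro!: derivative_eq_intros)
        then have "(\<lambda>h. (exp (h * p x) - 1) / h) \<midarrow>0\<rightarrow> p x"
          by (simp add: DERIV_def)
        then have "(\<lambda>i. (exp (Y i * p x) - 1) / Y i) \<longlonglongrightarrow> p x"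
          using Y(2) Y0 unfolding tendsto_at_iff_sequentially comp_def by auto
        then show "(\<lambda>i. f x * ((exp (Y i * p x) - 1) / Y i)) \<longlonglongrightarrow> f x * p x"
          by (intro tendsto_intros)
      qed
      show "AE x in M. norm (f x * ((exp (Y i * p x) - 1) / Y i)) \<le> w x" for i
        using quotient_bound[OF Y] by auto
    qed measurable
    then have "(\<lambda>i. (I (X (i + N)) - I 0) / X (i + N)) \<longlonglongrightarrow> (\<integral>x. f x * p x \<partial>M)"
      unfolding quotient[symmetric] by (simp only: Y_def)
    then show "((\<lambda>h. (I h - I 0) / h) \<circ> X) \<longlonglongrightarrow> (\<integral>x. f x * p x \<partial>M)"
      unfolding comp_def by (rule LIMSEQ_offset)
  qed
  then have "(I has_field_derivative (\<integral>x. f x * p x \<partial>M)) (at 0)"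
    by (simp add: DERIV_def)
  then show ?thesis
    by (simp add: I_def[abs_def])
qed

section \<open>Integrability and the gradient\<close>

text \<open>
  Completing the square in \<open>\<beta> * x\<close> costs half of the quadratic decay; the remaining
  \<open>exp (- \<alpha> / 2 * x\<^sup>2)\<close> is a multiple of a normal density, which has moments of all orders.
\<close>
lemma integrable_abs_power_mult_gaussian:
  fixes \<alpha> \<beta> c :: real
  assumes "\<alpha> > 0"
  shows "integrable lborel (\<lambda>x. \<bar>x\<bar> ^ n * exp (- \<alpha> * x\<^sup>2 + \<beta> * x + c))"
proof -
  define \<sigma> where "\<sigma> = 1 / sqrt \<alpha>"
  have \<sigma>: "\<sigma> > 0" "\<sigma>\<^sup>2 = 1 / \<alpha>"
    using assms by (auto simp: \<sigma>_def power_divide)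
  define C where "C = sqrt (2 * pi * \<sigma>\<^sup>2) * exp (\<beta>\<^sup>2 / (2 * \<alpha>) + c)"
  have "integrable lborel (\<lambda>x. C * (normal_density 0 \<sigma> x * \<bar>x - 0\<bar> ^ n))"
    using integrable_normal_moment_abs[OF \<sigma>(1), of 0 n] by (intro integrable_mult_right) auto
  then show ?thesis
  proof (rule Bochner_Integration.integrable_bound)
    show "AE x in lborel. norm (\<bar>x\<bar> ^ n * exp (- \<alpha> * x\<^sup>2 + \<beta> * x + c))
            \<le> norm (C * (normal_density 0 \<sigma> x * \<bar>x - 0\<bar> ^ n))"
    proof (rule AE_I2)
      fix x :: real
      have "0 \<le> (\<alpha> * x - \<beta>)\<^sup>2 / (2 * \<alpha>)"
        using assms by simp
      also have "\<dots> = \<alpha> / 2 * x\<^sup>2 - \<beta> * x + \<beta>\<^sup>2 / (2 * \<alpha>)"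
        using assms by (simp add: field_simps power2_eq_square)
      finally have "exp (- \<alpha> * x\<^sup>2 + \<beta> * x + c) \<le> exp ((\<beta>\<^sup>2 / (2 * \<alpha>) + c) + (- (\<alpha> / 2 * x\<^sup>2)))"
        by simp
      also have "\<dots> = C * normal_density 0 \<sigma> x"
      proof -
        have "- (\<alpha> / 2 * x\<^sup>2) = - (x - 0)\<^sup>2 / (2 * \<sigma>\<^sup>2)"
        proof -
          have "\<alpha> = 1 / \<sigma>\<^sup>2"
            using assms \<sigma>(2) by simp
          then show ?thesis by simp
        qed
        then show ?thesis
          using \<sigma>(1) unfolding C_def normal_density_def exp_add by (simp add: real_sqrt_mult)
      qed
      finally have "\<bar>x\<bar> ^ n * exp (- \<alpha> * x\<^sup>2 + \<beta> * x + c) \<le> \<bar>x\<bar> ^ n * (C * normal_density 0 \<sigma> x)"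
        by (rule mult_left_mono) simp
      then show "norm (\<bar>x\<bar> ^ n * exp (- \<alpha> * x\<^sup>2 + \<beta> * x + c))
            \<le> norm (C * (normal_density 0 \<sigma> x * \<bar>x - 0\<bar> ^ n))"
        by (simp add: abs_mult C_def algebra_simps)
    qed
  qed measurable
qed

lemma norm_gauss_integrand:
  "norm (gauss_integrand n (a, \<kappa>, \<gamma>) x) = \<bar>x\<bar> ^ n * exp (- Re a * x\<^sup>2 + Re \<kappa> * x + Re \<gamma>)"
proof -
  have "Re (a * (complex_of_real x)\<^sup>2) = Re a * x\<^sup>2"
    by (simp flip: of_real_power)
  then show ?thesis
    by (simp add: norm_mult norm_power)
qed

lemma borel_measurable_gauss_integrand [measurable]:
  "gauss_integrand n (a, \<kappa>, \<gamma>) \<in> borel_measurable borel"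
  unfolding gauss_integrand.simps[abs_def] by measurable

lemma integrable_gauss_integrand:
  assumes "Re a > 0"
  shows "integrable lborel (gauss_integrand n (a, \<kappa>, \<gamma>))"
  by (rule Bochner_Integration.integrable_bound
        [OF integrable_abs_power_mult_gaussian[OF assms, of n "Re \<kappa>" "Re \<gamma>"]])
     (auto simp: norm_gauss_integrand simp del: gauss_integrand.simps)

lemma gauss_integral_shift:
  "gauss_integral n (a, \<kappa>, \<gamma>) = exp \<gamma> * gauss_integral n (a, \<kappa>, 0)"
  unfolding gauss_integral_def integral_mult_right_zero[symmetric]
  by (intro Bochner_Integration.integral_cong) (simp_all add: exp_add)

lemma gauss_integral_gradient:
  assumes a: "Re a > 0"
  shows "has_complex_gradient (gauss_integral n)
    (- gauss_integral (n + 2) (a, \<kappa>, \<gamma>), gauss_integral (n + 1) (a, \<kappa>, \<gamma>), gauss_integral n (a, \<kappa>, \<gamma>))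
    (a, \<kappa>, \<gamma>)"
proof -
  define f where "f = gauss_integrand n (a, \<kappa>, \<gamma>)"
  have [measurable]: "f \<in> borel_measurable borel"
    unfolding f_def by measurable
  \<comment> \<open>The tilt by \<open>Re a / 2\<close> leaves the modulus of an integrand whose quadratic coefficient is
    \<open>Re a / 2\<close>, which is positive.\<close>
  have "((\<lambda>h. \<integral>x. f x * exp (h * - complex_of_real (x\<^sup>2)) \<partial>lborel) has_field_derivative
          (\<integral>x. f x * - complex_of_real (x\<^sup>2) \<partial>lborel)) (at 0)"
  proof (rule has_field_derivative_exponential_tilt[where \<delta> = "Re a / 2"])
    have "norm (f x) * exp (Re a / 2 * norm (- complex_of_real (x\<^sup>2)))
            = norm (gauss_integrand n (of_real (Re a / 2), \<kappa>, \<gamma>) x)" for x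
      unfolding f_def norm_gauss_integrand by (simp add: exp_add[symmetric] algebra_simps flip: of_real_power)
    then show "integrable lborel (\<lambda>x. norm (f x) * exp (Re a / 2 * norm (- complex_of_real (x\<^sup>2))))"
      using a by (auto intro!: integrable_norm integrable_gauss_integrand simp del: gauss_integrand.simps)
  qed (use a in auto)
  then have da: "((\<lambda>z. gauss_integral n (z, \<kappa>, \<gamma>)) has_field_derivative - gauss_integral (n + 2) (a, \<kappa>, \<gamma>)) (at a)"
    using DERIV_shift[of "\<lambda>z. gauss_integral n (z, \<kappa>, \<gamma>)" _ 0 a]
    by (simp add: gauss_integral_def f_def mult_exp_exp power2_eq_square algebra_simps)
  \<comment> \<open>Here the tilt is majorised by \<open>exp x + exp (- x)\<close>, a shift of \<open>\<kappa>\<close> by \<open>1\<close> in both directions.\<close>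
  have "((\<lambda>h. \<integral>x. f x * exp (h * complex_of_real x) \<partial>lborel) has_field_derivative
          (\<integral>x. f x * complex_of_real x \<partial>lborel)) (at 0)"
  proof (rule has_field_derivative_exponential_tilt[where \<delta> = 1])
    have dom: "integrable lborel (\<lambda>x. norm (gauss_integrand n (a, \<kappa> + 1, \<gamma>) x) + norm (gauss_integrand n (a, \<kappa> - 1, \<gamma>) x))"
      using a by (intro Bochner_Integration.integrable_add integrable_norm integrable_gauss_integrand)
    have "norm (f x) * exp (1 * norm (complex_of_real x))
            \<le> norm (gauss_integrand n (a, \<kappa> + 1, \<gamma>) x) + norm (gauss_integrand n (a, \<kappa> - 1, \<gamma>) x)" for x
    proof -
      have "norm (f x) * exp \<bar>x\<bar> \<le> norm (f x) * (exp x + exp (- x))"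
        by (intro mult_left_mono) (auto simp: abs_if)
      also have "\<dots> = norm (gauss_integrand n (a, \<kappa> + 1, \<gamma>) x) + norm (gauss_integrand n (a, \<kappa> - 1, \<gamma>) x)"
        unfolding f_def norm_gauss_integrand by (simp add: distrib_left mult.assoc mult_exp_exp) (simp add: algebra_simps)
      finally show ?thesis by simp
    qed
    then show "integrable lborel (\<lambda>x. norm (f x) * exp (1 * norm (complex_of_real x)))"
      by (intro Bochner_Integration.integrable_bound[OF dom]) auto
  qed auto
  then have dk: "((\<lambda>z. gauss_integral n (a, z, \<gamma>)) has_field_derivative gauss_integral (n + 1) (a, \<kappa>, \<gamma>)) (at \<kappa>)"
    using DERIV_shift[of "\<lambda>z. gauss_integral n (a, z, \<gamma>)" _ 0 \<kappa>]
    by (simp add: gauss_integral_def f_def mult_exp_exp algebra_simps)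
  have dg: "((\<lambda>z. gauss_integral n (a, \<kappa>, z)) has_field_derivative gauss_integral n (a, \<kappa>, \<gamma>)) (at \<gamma>)"
    using DERIV_cmult_right[OF DERIV_exp, of "gauss_integral n (a, \<kappa>, 0)" \<gamma>]
    by (simp only: gauss_integral_shift[symmetric])
  from da dk dg show ?thesis by simp
qed

section \<open>Integration by parts\<close>

lemma tendsto_abs_power_mult_gaussian:
  fixes \<alpha> \<beta> c :: real
  assumes "\<alpha> > 0"
  shows "((\<lambda>x. \<bar>x\<bar> ^ n * exp (- \<alpha> * x\<^sup>2 + \<beta> * x + c)) \<longlongrightarrow> 0) at_top"
  using assms by real_asymp

lemma tendsto_gauss_integrand:
  assumes "Re a > 0"
  shows "(gauss_integrand n (a, \<kappa>, \<gamma>) \<longlongrightarrow> 0) at_top"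
    and "(gauss_integrand n (a, \<kappa>, \<gamma>) \<longlongrightarrow> 0) at_bot"
proof -
  have top: "(gauss_integrand n (a, \<kappa>, \<gamma>) \<longlongrightarrow> 0) at_top" for \<kappa>
    by (rule tendsto_norm_zero_cancel, unfold norm_gauss_integrand)
       (rule tendsto_abs_power_mult_gaussian[OF assms])
  show "(gauss_integrand n (a, \<kappa>, \<gamma>) \<longlongrightarrow> 0) at_top"
    by (rule top)
  have "norm (gauss_integrand n (a, \<kappa>, \<gamma>) (- x)) = norm (gauss_integrand n (a, - \<kappa>, \<gamma>) x)" for x
    unfolding norm_gauss_integrand by simp
  then show "(gauss_integrand n (a, \<kappa>, \<gamma>) \<longlongrightarrow> 0) at_bot"
    using tendsto_norm_zero[OF top[of "- \<kappa>"]]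
    by (subst tendsto_norm_zero_iff[symmetric]) (simp only: filterlim_at_bot_mirror)
qed

lemma integral_derivative_eq_zero_real_line:
  fixes F f :: "real \<Rightarrow> 'a :: euclidean_space"
  assumes "\<And>x. (F has_vector_derivative f x) (at x)"
    and "continuous_on UNIV f" "integrable lborel f"
    and "(F \<longlongrightarrow> 0) at_top" "(F \<longlongrightarrow> 0) at_bot"
  shows "(\<integral>x. f x \<partial>lborel) = 0"
proof -
  have "(LBINT x=-\<infinity>..\<infinity>. f x) = 0 - 0"
    using assms
    by (intro interval_integral_FTC_integrable[where F = F])
       (auto simp: continuous_on_eq_continuous_at einterval_eq_UNIV set_integrable_def
             ereal_tendsto_simps)
  then show ?thesis
    by (simp add: interval_lebesgue_integral_def set_lebesgue_integral_def einterval_eq_UNIV)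
qed

text \<open>
  The integral of the derivative of the \<open>n\<close>-th integrand is zero. For \<open>n = 0\<close> the truncated index
  \<open>n - 1\<close> is harmless, because its coefficient vanishes.
\<close>
lemma gauss_integral_recurrence:
  assumes a: "Re a > 0"
  shows "2 * a * gauss_integral (n + 1) (a, \<kappa>, \<gamma>)
    = \<kappa> * gauss_integral n (a, \<kappa>, \<gamma>) + of_nat n * gauss_integral (n - 1) (a, \<kappa>, \<gamma>)"
proof -
  let ?g = "\<lambda>n. gauss_integrand n (a, \<kappa>, \<gamma>)"
  define f where "f x = \<kappa> * ?g n x + of_nat n * ?g (n - 1) x - 2 * a * ?g (n + 1) x" for x
  have int: "integrable lborel (?g m)" for m
    by (rule integrable_gauss_integrand[OF a])
  have "(\<integral>x. f x \<partial>lborel) = 0"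
  proof (rule integral_derivative_eq_zero_real_line)
    fix x :: real
    have "((\<lambda>z. z ^ n * exp (- a * z ^ 2 + \<kappa> * z + \<gamma>)) has_field_derivative f x) (at (of_real x))"
      unfolding f_def
      by (auto intro!: derivative_eq_intros simp: algebra_simps power2_eq_square)
    then show "(?g n has_vector_derivative f x) (at x)"
      using has_vector_derivative_real_field[of "\<lambda>z. z ^ n * exp (- a * z ^ 2 + \<kappa> * z + \<gamma>)" "f x" x UNIV]
      by (simp add: gauss_integrand.simps[abs_def])
  next
    show "continuous_on UNIV f"
      unfolding f_def gauss_integrand.simps by (intro continuous_intros)
    show "integrable lborel f"
      unfolding f_def using int by (intro Bochner_Integration.integrable_diff Bochner_Integration.integrable_add integrable_mult_right)
  qed (rule tendsto_gauss_integrand[OF a])+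
  moreover have "(\<integral>x. f x \<partial>lborel) = \<kappa> * gauss_integral n (a, \<kappa>, \<gamma>)
      + of_nat n * gauss_integral (n - 1) (a, \<kappa>, \<gamma>) - 2 * a * gauss_integral (n + 1) (a, \<kappa>, \<gamma>)"
    unfolding f_def gauss_integral_def
    using int by (simp add: Bochner_Integration.integral_diff Bochner_Integration.integral_add del: gauss_integrand.simps)
  ultimately show ?thesis by simp
qed

section \<open>The value for the monomial of degree zero\<close>

lemma gauss_integral_standard: "gauss_integral 0 (1, 0, 0) = complex_of_real (sqrt pi)"
proof -
  have "exp (- x\<^sup>2) = sqrt pi * normal_density 0 (1 / sqrt 2) x" for x :: real
    by (simp add: normal_density_def power_divide)
  then have "(\<integral>x. exp (- x\<^sup>2) \<partial>lborel) = sqrt pi"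
    using integral_normal_density[of "1 / sqrt 2" 0] by simp
  moreover have "gauss_integrand 0 (1, 0, 0) = (\<lambda>x. complex_of_real (exp (- x\<^sup>2)))"
    by (rule ext) (simp flip: exp_of_real)
  ultimately show ?thesis
    unfolding gauss_integral_def by (simp only: integral_complex_of_real)
qed

text \<open>
  For \<open>\<kappa> = 0\<close> the recurrence gives \<open>G 2 = G 0 / (2 * a)\<close>, and \<open>dG 0 / da = - G 2\<close>, hence the product
  \<open>csqrt a * G 0\<close> has derivative zero. The right half-plane is convex and avoids the branch cut of
  \<open>csqrt\<close>, so the product is constant there and can be evaluated at \<open>a = 1\<close>.
\<close>
lemma gauss_integral_0_centred:
  assumes a: "Re a > 0"
  shows "gauss_integral 0 (a, 0, 0) = complex_of_real (sqrt pi) / csqrt a"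
proof -
  let ?H = "{z. Re z > 0}"
  have "\<exists>c. \<forall>z\<in>?H. csqrt z * gauss_integral 0 (z, 0, 0) = c"
  proof (rule has_field_derivative_zero_constant)
    show "convex ?H"
      by (rule convex_halfspace_Re_gt)
    fix z assume "z \<in> ?H"
    then have z: "Re z > 0" "z \<notin> \<real>\<^sub>\<le>\<^sub>0" "csqrt z \<noteq> 0"
      by (auto elim: nonpos_Reals_cases)
    have der: "((\<lambda>z. gauss_integral 0 (z, 0, 0)) has_field_derivative - gauss_integral 2 (z, 0, 0)) (at z)"
      using gauss_integral_gradient[OF z(1), of 0 0 0] by (simp add: numeral_2_eq_2)
    have "2 * z * gauss_integral 2 (z, 0, 0) = gauss_integral 0 (z, 0, 0)"
      using gauss_integral_recurrence[OF z(1), of 1 0 0]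
      by (simp add: numeral_2_eq_2)
    then have "2 * (csqrt z * csqrt z) * gauss_integral 2 (z, 0, 0) = gauss_integral 0 (z, 0, 0)"
      by (simp flip: power2_eq_square)
    then have "gauss_integral 0 (z, 0, 0) / (2 * csqrt z) + csqrt z * - gauss_integral 2 (z, 0, 0) = 0"
      using z(3) by (simp add: field_simps del: power2_csqrt)
    moreover have "((\<lambda>z. csqrt z * gauss_integral 0 (z, 0, 0)) has_field_derivative
        (gauss_integral 0 (z, 0, 0) / (2 * csqrt z) + csqrt z * - gauss_integral 2 (z, 0, 0))) (at z)"
      using DERIV_mult[OF has_field_derivative_csqrt[OF z(2)] der] by (simp add: field_simps)
    ultimately show "((\<lambda>z. csqrt z * gauss_integral 0 (z, 0, 0)) has_field_derivative 0) (at z within ?H)"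
      by (simp add: has_field_derivative_at_within)
  qed
  then obtain c where c: "\<And>z. Re z > 0 \<Longrightarrow> csqrt z * gauss_integral 0 (z, 0, 0) = c"
    by blast
  from c[of 1] have "c = complex_of_real (sqrt pi)"
    by (simp add: gauss_integral_standard)
  moreover have "csqrt a \<noteq> 0"
    using a by auto
  ultimately show ?thesis
    using c[OF a] by (simp add: field_simps)
qed

text \<open>
  Completing the square would move the line of integration into the complex plane. The computation
  stays on the real line if the equation \<open>dG 0 / d\<kappa> = G 1 = \<kappa> / (2 * a) * G 0\<close> is solved with the integrating factor
  \<open>exp (- \<kappa>\<^sup>2 / (4 * a))\<close>.
\<close>
lemma gauss_integral_0:
  assumes a: "Re a > 0"
  shows "gauss_integral 0 (a, \<kappa>, \<gamma>) =
    exp (\<kappa>\<^sup>2 / (4 * a) + \<gamma>) * (complex_of_real (sqrt pi) / csqrt a)"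
proof -
  have a0: "a \<noteq> 0"
    using a by auto
  define F where "F z = exp (- (z\<^sup>2 / (4 * a))) * gauss_integral 0 (a, z, 0)" for z
  have "(F has_field_derivative 0) (at z)" for z
  proof -
    have der: "((\<lambda>z. gauss_integral 0 (a, z, 0)) has_field_derivative gauss_integral 1 (a, z, 0)) (at z)"
      using gauss_integral_gradient[OF a, of 0 z 0] by simp
    have "gauss_integral 1 (a, z, 0) = z / (2 * a) * gauss_integral 0 (a, z, 0)"
      using gauss_integral_recurrence[OF a, of 0 z 0] a0 by (simp add: field_simps)
    moreover have "((\<lambda>z. exp (- (z\<^sup>2 / (4 * a)))) has_field_derivative
        exp (- (z\<^sup>2 / (4 * a))) * - (z / (2 * a))) (at z)"
      using a0 by (auto intro!: derivative_eq_intros simp: field_simps)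
    ultimately show ?thesis
      unfolding F_def using DERIV_mult[OF _ der] by (fastforce simp: algebra_simps)
  qed
  then obtain c where "\<And>z. F z = c"
    using has_field_derivative_zero_constant[of UNIV F] by auto
  then have "F \<kappa> = F 0"
    by simp
  then have "gauss_integral 0 (a, \<kappa>, 0) = exp (\<kappa>\<^sup>2 / (4 * a)) * gauss_integral 0 (a, 0, 0)"
    by (simp add: F_def exp_minus field_simps)
  then show ?thesis
    by (subst gauss_integral_shift) (simp add: gauss_integral_0_centred[OF a] exp_add)
qed

section \<open>Reduction to Hermite polynomials\<close>

text \<open>
  Both sides satisfy the same two-term recurrence in \<open>n\<close>: multiplying \<open>gauss_integral_recurrence\<close>
  for \<open>G (n + 2)\<close> by \<open>2 * (2 * csqrt a) ^ n\<close> turns it into \<open>scaled_hermite_rec\<close> at \<open>\<kappa> / (2 * csqrt a)\<close>.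
\<close>
lemma gauss_integral_hermite:
  assumes a: "Re a > 0"
  shows "(2 * csqrt a) ^ n * gauss_integral n (a, \<kappa>, \<gamma>)
    = scaled_hermite n (\<kappa> / (2 * csqrt a)) * gauss_integral 0 (a, \<kappa>, \<gamma>)"
proof -
  define s where "s = csqrt a"
  define G where "G m = gauss_integral m (a, \<kappa>, \<gamma>)" for m
  have s: "s \<noteq> 0" "a = s\<^sup>2"
    using a by (auto simp: s_def)
  have rec: "2 * s\<^sup>2 * G (m + 1) = \<kappa> * G m + of_nat m * G (m - 1)" for m
    using gauss_integral_recurrence[OF a, of m \<kappa> \<gamma>] by (simp add: G_def s(2))
  have "(2 * s) ^ n * G n = scaled_hermite n (\<kappa> / (2 * s)) * G 0"
  proof (induction n rule: less_induct)
    case (less n)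
    consider "n = 0" | "n = 1" | m where "n = m + 2"
      by (metis One_nat_def add_2_eq_Suc' not0_implies_Suc)
    then show ?case
    proof cases
      case 1
      then show ?thesis by (simp add: scaled_hermite_0)
    next
      case 2
      have "s * (2 * s * G 1) = s * (\<kappa> / s * G 0)"
        using rec[of 0] s(1) by (simp add: power2_eq_square mult_ac)
      then show ?thesis
        using s(1) unfolding 2 scaled_hermite_1 by (simp add: field_simps)
    next
      case 3
      define x where "x = \<kappa> / (2 * s)"
      have \<kappa>: "\<kappa> = 2 * s * x"
        using s(1) by (simp add: x_def)
      have IH: "(2 * s) ^ m * G m = scaled_hermite m x * G 0"
        "(2 * s) ^ (m + 1) * G (m + 1) = scaled_hermite (m + 1) x * G 0"
        using less.IH[of m] less.IH[of "m + 1"] 3 by (simp_all add: x_def)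
      have "(2 * s) ^ (m + 2) * G (m + 2) = 2 * (2 * s) ^ m * (2 * s\<^sup>2 * G (m + 1 + 1))"
        by (simp add: power_add power2_eq_square)
      also have "\<dots> = 2 * (2 * s) ^ m * (\<kappa> * G (m + 1) + of_nat (m + 1) * G m)"
        by (subst rec) simp
      also have "\<dots> = 2 * x * ((2 * s) ^ (m + 1) * G (m + 1)) + 2 * of_nat (m + 1) * ((2 * s) ^ m * G m)"
        by (simp add: \<kappa> algebra_simps)
      also have "\<dots> = (2 * x * scaled_hermite (m + 1) x + 2 * of_nat (m + 1) * scaled_hermite m x) * G 0"
        by (simp only: IH) (simp add: algebra_simps)
      also have "\<dots> = scaled_hermite (m + 2) x * G 0"
        using scaled_hermite_rec[of "m + 1" x] by simp
      finally show ?thesis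
        unfolding 3 x_def .
    qed
  qed
  then show ?thesis
    by (simp add: s_def G_def)
qed

theorem mainTheorem4:
  fixes a \<kappa> \<gamma> :: complex and n :: nat
  assumes "Re a > 0"
  shows "integrable lborel (gauss_integrand n (a, \<kappa>, \<gamma>))
    \<and> gauss_integral n (a, \<kappa>, \<gamma>) =
        (2 * csqrt a) powi (- int n) * scaled_hermite n (\<kappa> / (2 * csqrt a))
          * gauss_integral 0 (a, \<kappa>, \<gamma>)
    \<and> gauss_integral 0 (a, \<kappa>, \<gamma>) =
        exp (\<kappa> ^ 2 / (4 * a) + \<gamma>) * (complex_of_real (sqrt pi) / csqrt a)
    \<and> has_complex_gradient (gauss_integral n)
        (- gauss_integral (n + 2) (a, \<kappa>, \<gamma>),
         gauss_integral (n + 1) (a, \<kappa>, \<gamma>),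
         gauss_integral n (a, \<kappa>, \<gamma>))
        (a, \<kappa>, \<gamma>)"
proof (intro conjI)
  have "2 * csqrt a \<noteq> 0"
    using assms by auto
  then show "gauss_integral n (a, \<kappa>, \<gamma>) =
        (2 * csqrt a) powi (- int n) * scaled_hermite n (\<kappa> / (2 * csqrt a))
          * gauss_integral 0 (a, \<kappa>, \<gamma>)"
    unfolding mult.assoc gauss_integral_hermite[OF assms, symmetric]
    by (simp add: power_int_minus field_simps)
qed (rule integrable_gauss_integrand gauss_integral_0 gauss_integral_gradient, rule assms)+

end
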